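(* Let $\mathcal{X}$ be a set of datasets equipped with a distance $d:\mathcal{X}\times\mathcal{X}\to\mathbb{Z}_{\ge 0}\cup\{\infty\}$ that is symmetric, satisfies $d(\mathbf{x},\mathbf{x})=0$ and the triangle inequality; call $\mathbf{x},\mathbf{x}'$ neighboring if $d(\mathbf{x},\mathbf{x}')\le 1$. Let $f:\mathcal{X}\to\mathbb{R}$, let $\varepsilon>0$, and for every $\mathbf{x}\in\mathcal{X}$ assume that $Z(\mathbf{x})=\int_{\mathbb{R}} e^{q_{\texttt{plm}}(y;\mathbf{x})\varepsilon/2}\,dy$ is finite and positive. Let $M_{\texttt{plm}}$ be the mechanism that on input $\mathbf{x}$ outputs $y\in\mathbb{R}$ drawn from the density $\pi_{M_{\texttt{plm}}}(y)=e^{q_{\texttt{plm}}(y;\mathbf{x})\varepsilon/2}/Z(\mathbf{x})$ (with $q_{\texttt{plm}}$ as defined in the context). Then $M_{\texttt{plm}}$ is $\varepsilon$-differentially private: for all neighboring $\mathbf{x},\mathbf{x}'$ and all measurable $S\subseteq\mathbb{R}$, $\Pr[M_{\texttt{plm}}(\mathbf{x})\in S]\le e^{\varepsilon}\Pr[M_{\texttt{plm}}(\mathbf{x}')\in S]$.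
   Context: For $\mathbf{x}\in\mathcal{X}$ and integer $\ell\ge 0$ define $\overline{f}(\mathbf{x};\ell)=\sup\{f(\mathbf{x}'):d(\mathbf{x},\mathbf{x}')\le\ell\}$ and $\underline{f}(\mathbf{x};\ell)=\inf\{f(\mathbf{x}'):d(\mathbf{x},\mathbf{x}')\le\ell\}$. For $y\in\mathbb{R}$ define $\ell(y;\mathbf{x})=\inf\{\ell\in\mathbb{Z}_{\ge0}:\underline{f}(\mathbf{x};\ell)\le y\le\overline{f}(\mathbf{x};\ell)\}$ (with $\inf\emptyset=\infty$). The quality score $q_{\texttt{plm}}(y;\mathbf{x})$ is defined by: $-q_{\texttt{plm}}(f(\mathbf{x});\mathbf{x})=1$; if $y>f(\mathbf{x})$ and $L=\ell(y;\mathbf{x})<\infty$, then $-q_{\texttt{plm}}(y;\mathbf{x})=L+\frac{y-\overline{f}(\mathbf{x};L-1)}{\overline{f}(\mathbf{x};L)-\overline{f}(\mathbf{x};L-1)}$; if $y<f(\mathbf{x})$ and $L=\ell(y;\mathbf{x})<\infty$, then $-q_{\texttt{plm}}(y;\mathbf{x})=L+\frac{\underline{f}(\mathbf{x};L-1)-y}{\underline{f}(\mathbf{x};L-1)-\underline{f}(\mathbf{x};L)}$; if $\ell(y;\mathbf{x})=\infty$ then $q_{\texttt{plm}}(y;\mathbf{x})=-\infty$ and $e^{-\infty}=0$.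
   Formalization: When distinct datasets are at distance 0, ℓ(y;x)=0 with y≠f(x) can occur and the score's formula refers to the undefined radius −1; the formal version sets −q(y;x)=1 there, and agrees with the stated score wherever that is defined. *)

theory Defs
  imports "HOL-Analysis.Analysis"
begin

text \<open>
  The space of datasets is a carrier set \<open>X\<close>; only values of \<open>d\<close> and \<open>f\<close> on \<open>X\<close> matter.
  The supremum and infimum of \<open>f\<close> over a ball may be infinite, hence the type \<^typ>\<open>ereal\<close>.
\<close>

definition f_upper :: "'a set \<Rightarrow> ('a \<Rightarrow> 'a \<Rightarrow> enat) \<Rightarrow> ('a \<Rightarrow> real) \<Rightarrow> 'a \<Rightarrow> nat \<Rightarrow> ereal" where
  "f_upper X d f x l = (SUP x' \<in> {x' \<in> X. d x x' \<le> enat l}. ereal (f x'))"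

definition f_lower :: "'a set \<Rightarrow> ('a \<Rightarrow> 'a \<Rightarrow> enat) \<Rightarrow> ('a \<Rightarrow> real) \<Rightarrow> 'a \<Rightarrow> nat \<Rightarrow> ereal" where
  "f_lower X d f x l = (INF x' \<in> {x' \<in> X. d x x' \<le> enat l}. ereal (f x'))"

definition ell :: "'a set \<Rightarrow> ('a \<Rightarrow> 'a \<Rightarrow> enat) \<Rightarrow> ('a \<Rightarrow> real) \<Rightarrow> real \<Rightarrow> 'a \<Rightarrow> enat" where
  "ell X d f y x =
     Inf {enat l | l. f_lower X d f x l \<le> ereal y \<and> ereal y \<le> f_upper X d f x l}"

text \<open>
  If \<open>d\<close> separates points, then \<open>ell X d f y x = 0\<close> holds only for \<open>y = f x\<close> (see
  \<open>ell_eq_0_iff\<close> below), and the clause \<open>L = 0\<close> is never reached. If distinct points may be at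
  distance 0, then \<open>L = 0\<close> can occur with \<open>y \<noteq> f x\<close>; the quotients, which involve the
  radius \<open>L - 1\<close>, are then meaningless, and the score is the same as at \<open>f x\<close>.

  For \<open>L \<ge> 1\<close> the denominators are positive. If the supremum (infimum) at radius \<open>L\<close> is infinite,
  the quotient is a real number divided by \<open>\<infinity>\<close>, which is 0.
\<close>

definition q_plm :: "'a set \<Rightarrow> ('a \<Rightarrow> 'a \<Rightarrow> enat) \<Rightarrow> ('a \<Rightarrow> real) \<Rightarrow> real \<Rightarrow> 'a \<Rightarrow> ereal" where
  "q_plm X d f y x = -
     (if y = f x then 1
      else case ell X d f y x of
        \<infinity> \<Rightarrow> \<infinity>
      | enat L \<Rightarrow>
          if L = 0 then 1
          else if y > f x then
            ereal (real L) + (ereal y - f_upper X d f x (L - 1))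
                             / (f_upper X d f x L - f_upper X d f x (L - 1))
          else
            ereal (real L) + (f_lower X d f x (L - 1) - ereal y)
                             / (f_lower X d f x (L - 1) - f_lower X d f x L))"

definition exp_ereal :: "ereal \<Rightarrow> ennreal" where
  "exp_ereal q =
     (if q = -\<infinity> then 0 else if q = \<infinity> then \<infinity> else ennreal (exp (real_of_ereal q)))"

definition Z_plm :: "'a set \<Rightarrow> ('a \<Rightarrow> 'a \<Rightarrow> enat) \<Rightarrow> ('a \<Rightarrow> real) \<Rightarrow> real \<Rightarrow> 'a \<Rightarrow> ennreal" where
  "Z_plm X d f \<epsilon> x = (\<integral>\<^sup>+ y. exp_ereal (q_plm X d f y x * ereal (\<epsilon> / 2)) \<partial>lborel)"

definition M_plm :: "'a set \<Rightarrow> ('a \<Rightarrow> 'a \<Rightarrow> enat) \<Rightarrow> ('a \<Rightarrow> real) \<Rightarrow> real \<Rightarrow> 'a \<Rightarrow> real measure" where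
  "M_plm X d f \<epsilon> x =
     density lborel (\<lambda>y. exp_ereal (q_plm X d f y x * ereal (\<epsilon> / 2)) / Z_plm X d f \<epsilon> x)"

definition differentially_private ::
    "'a set \<Rightarrow> ('a \<Rightarrow> 'a \<Rightarrow> enat) \<Rightarrow> real \<Rightarrow> ('a \<Rightarrow> real measure) \<Rightarrow> bool" where
  "differentially_private X d \<epsilon> M \<longleftrightarrow>
     (\<forall>x\<in>X. \<forall>x'\<in>X. d x x' \<le> 1 \<longrightarrow>
        (\<forall>S\<in>sets borel. measure (M x) S \<le> exp \<epsilon> * measure (M x') S))"

lemma ell_eq_0_iff:
  assumes "x \<in> X" and "\<And>x'. x' \<in> X \<Longrightarrow> d x x' = 0 \<longleftrightarrow> x' = x"
  shows "ell X d f y x = 0 \<longleftrightarrow> y = f x"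
proof -
  have ball: "{x' \<in> X. d x x' \<le> enat 0} = {x}"
    using assms by (auto simp: zero_enat_def[symmetric])
  let ?A = "{enat l | l. f_lower X d f x l \<le> ereal y \<and> ereal y \<le> f_upper X d f x l}"
  have "ell X d f y x = 0 \<longleftrightarrow> 0 \<in> ?A"
  proof
    assume "ell X d f y x = 0"
    then have "Inf ?A = 0" by (simp add: ell_def)
    then have "?A \<noteq> {}" and "(LEAST a. a \<in> ?A) = 0"
      unfolding Inf_enat_def by (auto split: if_splits)
    then show "0 \<in> ?A"
      by (metis (mono_tags, lifting) LeastI_ex ex_in_conv)
  next
    assume "0 \<in> ?A"
    then have "Inf ?A \<le> 0" by (rule Inf_lower)
    then show "ell X d f y x = 0" by (simp add: ell_def)
  qed
  also have "\<dots> \<longleftrightarrow> y = f x"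
    by (auto simp: f_lower_def f_upper_def ball zero_enat_def)
  finally show ?thesis .
qed

end

theory Submission
  imports Defs
begin

text \<open>
  The score has sensitivity 1: if \<open>x\<close> and \<open>x'\<close> are neighbours, every ball of radius \<open>l\<close> around
  one of them lies in the ball of radius \<open>l + 1\<close> around the other, so that the levels \<open>L\<close>, \<open>L'\<close>
  of \<open>y\<close> differ by at most 1. As \<open>- q\<close> lies between \<open>L\<close> and \<open>L + 1\<close>, only \<open>L = L' + 1\<close> is
  critical; there the interval that is interpolated at \<open>x\<close> has both endpoints to the right of those
  at \<open>x'\<close>, and the fraction \<open>(y - a) / (b - a)\<close> is antitone in \<open>a\<close> and \<open>b\<close>. The exponential weights,
  and after integration also the normalising constants, thus differ by a factor of at most
  \<open>exp (\<epsilon> / 2)\<close>. The case \<open>y < f x\<close> is the case \<open>y > f x\<close> for \<open>-f\<close> and \<open>-y\<close>.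
\<close>

section \<open>Interpolation fractions with a possibly infinite right endpoint\<close>

lemma ereal_fraction_bounds:
  fixes a y :: real and b :: ereal
  assumes "a < y" "ereal y \<le> b"
  shows "0 \<le> (ereal y - ereal a) / (b - ereal a)" "(ereal y - ereal a) / (b - ereal a) \<le> 1"
  using assms by (cases b; simp add: field_simps)+

lemma ereal_fraction_antimono:
  fixes a a' y :: real and b b' :: ereal
  assumes "a' \<le> a" "a < y" "ereal y \<le> b'" "b' \<le> b"
  shows "(ereal y - ereal a) / (b - ereal a) \<le> (ereal y - ereal a') / (b' - ereal a')"
proof (cases b)
  case (real r)
  with assms obtain r' where r': "b' = ereal r'" by (cases b') auto
  have le: "a' \<le> a" "a < y" "y \<le> r'" "r' \<le> r" using assms real r' by auto
  \<comment> \<open>The endpoints move one at a time: first \<open>b\<close> down to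
    \<open>b'\<close> with \<open>a\<close> fixed, then \<open>a\<close> down to
    \<open>a'\<close>.\<close>
  have "(y - a) / (r - a) \<le> (y - a) / (r' - a)"
    using le by (intro divide_left_mono) auto
  also have "\<dots> \<le> (y - a') / (r' - a')"
  proof -
    \<comment> \<open>This product is the difference of the two sides after cross-multiplication:
      \<open>(y - a') * (r' - a) - (y - a) * (r' - a')\<close>.\<close>
    have "0 \<le> (a - a') * (r' - y)" using le by simp
    then show ?thesis using le by (simp add: field_simps)
  qed
  finally show ?thesis using le real r' by simp
next
  case PInf
  then show ?thesis using ereal_fraction_bounds(1)[of a' y b'] assms by simp
next
  case MInf
  then show ?thesis using assms by simp
qed

section \<open>The level as a least admissible radius\<close>

lemma ell_eq_enat_iff:
  "ell X d f y x = enat n \<longleftrightarrow>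
     (f_lower X d f x n \<le> ereal y \<and> ereal y \<le> f_upper X d f x n) \<and>
     (\<forall>m<n. \<not> (f_lower X d f x m \<le> ereal y \<and> ereal y \<le> f_upper X d f x m))"
  (is "_ \<longleftrightarrow> ?P n \<and> _")
proof -
  let ?A = "{enat l | l. ?P l}"
  have lower: "ell X d f y x \<le> enat l" if "?P l" for l
    unfolding ell_def using that by (intro Inf_lower) blast
  \<comment> \<open>\<open>enat\<close> is well-ordered, so the infimum of a nonempty set is a
    minimum.\<close>
  have attained: "ell X d f y x \<in> ?A" if "?A \<noteq> {}"
    using that unfolding ell_def by (rule wellorder_InfI[OF some_in_eq[THEN iffD2]])
  show ?thesis
  proof
    assume n: "ell X d f y x = enat n"
    then have "?A \<noteq> {}" unfolding ell_def by (auto simp: Inf_enat_def split: if_splits)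
    then have "?P n" using attained n by auto
    moreover have "\<not> ?P m" if "m < n" for m using lower[of m] n that by auto
    ultimately show "?P n \<and> (\<forall>m<n. \<not> ?P m)" by blast
  next
    assume n: "?P n \<and> (\<forall>m<n. \<not> ?P m)"
    then have "?A \<noteq> {}" by blast
    then obtain l where l: "ell X d f y x = enat l" "?P l" using attained by blast
    then show "ell X d f y x = enat n" using lower[of n] n by (metis enat_ord_simps(1) le_neq_implies_less)
  qed
qed

lemma ell_eq_infinity_iff:
  "ell X d f y x = \<infinity> \<longleftrightarrow>
     (\<forall>n. \<not> (f_lower X d f x n \<le> ereal y \<and> ereal y \<le> f_upper X d f x n))"
  (is "_ \<longleftrightarrow> (\<forall>n. \<not> ?P n)")
proof
  assume inf: "ell X d f y x = \<infinity>"
  show "\<forall>n. \<not> ?P n"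
  proof (intro allI notI)
    fix n assume "?P n"
    then have "ell X d f y x \<le> enat n" unfolding ell_def by (intro Inf_lower) blast
    then show False using inf by simp
  qed
next
  assume "\<forall>n. \<not> ?P n"
  then show "ell X d f y x = \<infinity>"
    by (metis ell_eq_enat_iff not_infinity_eq)
qed

section \<open>Reflection of \<open>f\<close> and \<open>y\<close>\<close>

lemma f_upper_uminus: "f_upper X d (\<lambda>x. - f x) x l = - f_lower X d f x l"
  unfolding f_upper_def f_lower_def uminus_ereal.simps(1)[symmetric] ereal_SUP_uminus_eq ..

lemma f_lower_uminus: "f_lower X d (\<lambda>x. - f x) x l = - f_upper X d f x l"
  unfolding f_upper_def f_lower_def uminus_ereal.simps(1)[symmetric] ereal_INF_uminus_eq ..

lemma ell_uminus: "ell X d (\<lambda>x. - f x) (- y) x = ell X d f y x"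
proof -
  have "ereal (- y) \<le> - a \<longleftrightarrow> a \<le> ereal y" "- a \<le> ereal (- y) \<longleftrightarrow> ereal y \<le> a" for a
    by (cases a; simp)+
  then show ?thesis
    unfolding ell_def f_upper_uminus f_lower_uminus by (simp add: conj_commute)
qed

lemma q_plm_uminus: "q_plm X d (\<lambda>x. - f x) (- y) x = q_plm X d f y x"
proof -
  have "ereal (- y) - - a = a - ereal y" "- a - ereal (- y) = ereal y - a" for a
    by (cases a; simp)+
  moreover have "- a - - b = b - (a :: ereal)" for a b
    by (simp add: minus_ereal_def add.commute)
  ultimately show ?thesis
    unfolding q_plm_def ell_uminus f_upper_uminus f_lower_uminus
    by (auto split: enat.split)
qed

section \<open>Measurability and the exponential weight\<close>

lemma measurable_ell: "(\<lambda>y. ell X d f y x) \<in> borel \<rightarrow>\<^sub>M count_space UNIV"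
proof (rule measurable_count_space_eq2_countable[THEN iffD2], intro conjI ballI)
  fix e :: enat
  have "{y. ell X d f y x = e} \<in> sets borel"
  proof (cases e)
    case (enat n)
    show ?thesis unfolding enat ell_eq_enat_iff by measurable
  next
    case infinity
    show ?thesis unfolding infinity ell_eq_infinity_iff by measurable
  qed
  then show "(\<lambda>y. ell X d f y x) -` {e} \<inter> space borel \<in> sets borel"
    by (simp add: vimage_def)
qed auto

lemma borel_measurable_q_plm: "(\<lambda>y. q_plm X d f y x) \<in> borel_measurable borel"
  unfolding q_plm_def
\<comment> \<open>The level takes countably many values, so it may be frozen at a constant
  \<open>e\<close>; what remains is an explicit formula in \<open>y\<close>.\<close>
proof (rule measurable_compose_countable[OF _ measurable_ell])
  fix e :: enat
  show "(\<lambda>y. - (if y = f x then 1 else case e of \<infinity> \<Rightarrow> \<infinity> | enat L \<Rightarrow>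
          if L = 0 then 1
          else if y > f x then
            ereal (real L) + (ereal y - f_upper X d f x (L - 1))
                             / (f_upper X d f x L - f_upper X d f x (L - 1))
          else
            ereal (real L) + (f_lower X d f x (L - 1) - ereal y)
                             / (f_lower X d f x (L - 1) - f_lower X d f x L)))
        \<in> borel_measurable borel"
    by (cases e) simp_all
qed

lemma borel_measurable_exp_ereal: "exp_ereal \<in> borel_measurable borel"
  unfolding exp_ereal_def by measurable

lemma mono_exp_ereal: "a \<le> b \<Longrightarrow> exp_ereal a \<le> exp_ereal b"
  unfolding exp_ereal_def by (cases a; cases b) auto

lemma exp_ereal_add_real: "exp_ereal (a + ereal r) = ennreal (exp r) * exp_ereal a"
  unfolding exp_ereal_def
  by (cases a) (auto simp: exp_add ennreal_mult' mult.commute ennreal_mult_eq_top_iff)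

lemma borel_measurable_exp_q_plm:
  "(\<lambda>y. exp_ereal (q_plm X d f y x * ereal (\<epsilon> / 2))) \<in> borel_measurable borel"
  using borel_measurable_q_plm[of X d f x] borel_measurable_exp_ereal by measurable

section \<open>Balls around neighbours, and bounds on the score by the level\<close>

locale dataset_space =
  fixes X :: "'a set" and d :: "'a \<Rightarrow> 'a \<Rightarrow> enat"
  assumes d_refl: "\<And>x. x \<in> X \<Longrightarrow> d x x = 0"
    and d_sym: "\<And>x y. x \<in> X \<Longrightarrow> y \<in> X \<Longrightarrow> d x y = d y x"
    and d_triangle: "\<And>x y z. x \<in> X \<Longrightarrow> y \<in> X \<Longrightarrow> z \<in> X \<Longrightarrow> d x z \<le> d x y + d y z"
begin

lemma f_upper_ge: "x \<in> X \<Longrightarrow> ereal (f x) \<le> f_upper X d f x l"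
  unfolding f_upper_def by (rule SUP_upper) (simp add: d_refl)

lemma f_lower_le: "x \<in> X \<Longrightarrow> f_lower X d f x l \<le> ereal (f x)"
  unfolding f_lower_def by (rule INF_lower) (simp add: d_refl)

lemma ball_neighbour:
  assumes "x \<in> X" "x' \<in> X" "d x x' \<le> 1"
  shows "{z \<in> X. d x' z \<le> enat l} \<subseteq> {z \<in> X. d x z \<le> enat (Suc l)}"
proof safe
  fix z assume z: "z \<in> X" "d x' z \<le> enat l"
  have "d x z \<le> d x x' + d x' z" using assms z d_triangle by blast
  also have "\<dots> \<le> 1 + enat l" using assms z by (intro add_mono) auto
  finally show "d x z \<le> enat (Suc l)" by (simp add: one_enat_def)
qed

lemma f_upper_neighbour:
  assumes "x \<in> X" "x' \<in> X" "d x x' \<le> 1"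
  shows "f_upper X d f x' l \<le> f_upper X d f x (Suc l)"
  unfolding f_upper_def using ball_neighbour[OF assms] by (rule SUP_subset_mono) simp

lemma f_lower_neighbour:
  assumes "x \<in> X" "x' \<in> X" "d x x' \<le> 1"
  shows "f_lower X d f x (Suc l) \<le> f_lower X d f x' l"
  unfolding f_lower_def using ball_neighbour[OF assms] by (rule INF_superset_mono) simp

text \<open>Since \<open>x\<close> lies in each of its balls, \<open>y > f x\<close> satisfies the
  lower condition at every radius. Radius \<open>k\<close> can therefore fail only because the
  supremum there is below \<open>y\<close>, which makes it finite; the supremum at
  \<open>Suc k\<close> may still be infinite.\<close>

lemma f_upper_less_of_ell:
  assumes "x \<in> X" "f x < y" "ell X d f y x = enat (Suc k)"
  obtains a where "f_upper X d f x k = ereal a" "f x \<le> a" "a < y"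
    "ereal y \<le> f_upper X d f x (Suc k)"
proof -
  have "f_lower X d f x k \<le> ereal y"
    using f_lower_le[OF assms(1), where f = f and l = k] assms(2)
    by (metis ereal_less_eq(3) less_imp_le order_trans)
  then have "f_upper X d f x k < ereal y" and top: "ereal y \<le> f_upper X d f x (Suc k)"
    using assms(3) unfolding ell_eq_enat_iff by auto
  with f_upper_ge[OF assms(1), where f = f and l = k] show thesis
    by (cases "f_upper X d f x k") (auto intro: that)
qed

lemma q_plm_above:
  assumes "f x < y" "ell X d f y x = enat (Suc k)"
  shows "- q_plm X d f y x = ereal (real (Suc k)) +
    (ereal y - f_upper X d f x k) / (f_upper X d f x (Suc k) - f_upper X d f x k)"
  using assms unfolding q_plm_def by simp

lemma ell_self: "x \<in> X \<Longrightarrow> ell X d f (f x) x = 0"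
  using f_upper_ge[where f = f] f_lower_le[where f = f] by (simp add: zero_enat_def ell_eq_enat_iff)

lemma q_plm_level_0:
  assumes "ell X d f y x = 0"
  shows "- q_plm X d f y x = 1"
  using assms unfolding q_plm_def by (simp add: zero_enat_def)

lemma q_plm_level_infinity:
  assumes "x \<in> X" "ell X d f y x = \<infinity>"
  shows "- q_plm X d f y x = \<infinity>"
  \<comment> \<open>The clause \<open>y = f x\<close> cannot apply, because the level there is
    0.\<close>
  using assms ell_self[of x f] unfolding q_plm_def by auto

lemma q_plm_bounds_above:
  assumes "x \<in> X" "f x < y" "ell X d f y x = enat (Suc k)"
  shows "ereal (real (Suc k)) \<le> - q_plm X d f y x"
    and "- q_plm X d f y x \<le> ereal (real (Suc k)) + 1"
proof -
  obtain a where a: "f_upper X d f x k = ereal a" "a < y" "ereal y \<le> f_upper X d f x (Suc k)"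
    using f_upper_less_of_ell[OF assms] by metis
  note frac = ereal_fraction_bounds[OF a(2,3)]
  show "ereal (real (Suc k)) \<le> - q_plm X d f y x"
    unfolding q_plm_above[OF assms(2,3)] a(1)
    using frac(1) by (metis add_left_mono add.right_neutral)
  show "- q_plm X d f y x \<le> ereal (real (Suc k)) + 1"
    unfolding q_plm_above[OF assms(2,3)] a(1) using frac(2) by (rule add_left_mono)
qed

lemma q_plm_bounds:
  assumes "x \<in> X" "ell X d f y x = enat (Suc k)"
  shows "ereal (real (Suc k)) \<le> - q_plm X d f y x \<and> - q_plm X d f y x \<le> ereal (real (Suc k)) + 1"
proof -
  consider "f x < y" | "f x = y" | "y < f x" by linarith
  then show ?thesis
  proof cases
    case 1
    then show ?thesis using q_plm_bounds_above[OF assms(1) _ assms(2)] by simp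
  next
    case 2
    then show ?thesis using ell_self[OF assms(1), of f] assms(2) by (simp add: zero_enat_def)
  next
    case 3
    then show ?thesis
      using q_plm_bounds_above[of x "\<lambda>x. - f x" "- y" k] assms
      by (simp only: ell_uminus q_plm_uminus neg_less_iff_less)
  qed
qed

section \<open>Sensitivity of the score\<close>

lemma q_plm_neighbour_above:
  assumes X: "x \<in> X" "x' \<in> X" and nb: "d x x' \<le> 1" and y: "f x < y"
  shows "- q_plm X d f y x \<le> - q_plm X d f y x' + 1"
proof (cases "ell X d f y x'")
  case infinity
  then show ?thesis using q_plm_level_infinity[OF X(2)] by simp
next
  case (enat L')
  \<comment> \<open>The ball of radius \<open>L'\<close> around \<open>x'\<close> lies in that of
    radius \<open>Suc L'\<close> around \<open>x\<close>, so \<open>y\<close> is admissible there as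
    well.\<close>
  have "f_lower X d f x (Suc L') \<le> ereal y \<and> ereal y \<le> f_upper X d f x (Suc L')"
    using enat f_upper_neighbour[OF X nb, of f L'] f_lower_neighbour[OF X nb, of f L']
    unfolding ell_eq_enat_iff by (meson order_trans)
  then obtain L where L: "ell X d f y x = enat L" "L \<le> Suc L'"
    by (metis ell_eq_infinity_iff ell_eq_enat_iff not_infinity_eq not_less)
  \<comment> \<open>The maximum accounts for level 0, where the negated score is 1 and not
    0.\<close>
  have ge: "ereal (real (max 1 L')) \<le> - q_plm X d f y x'"
    using q_plm_bounds[OF X(2), of f y] q_plm_level_0[of f y x'] enat
    by (cases L') (auto simp: zero_enat_def max_def)
  show ?thesis
  \<comment> \<open>In the first case the crude bounds by the level suffice. Otherwise
    \<open>L = L' + 1\<close> with \<open>L' \<ge> 1\<close>, and the fractions must be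
    compared.\<close>
  proof (cases "L \<le> max 1 L'")
    case True
    have "- q_plm X d f y x \<le> ereal (real (max 1 L')) + 1"
    proof (cases L)
      case 0
      then have "- q_plm X d f y x = 1" using q_plm_level_0 L by (simp add: zero_enat_def)
      then show ?thesis by simp
    next
      case (Suc k)
      have "- q_plm X d f y x \<le> ereal (real L) + 1" using q_plm_bounds[OF X(1)] L Suc by blast
      also have "\<dots> \<le> ereal (real (max 1 L')) + 1" using True by simp
      finally show ?thesis .
    qed
    also have "\<dots> \<le> - q_plm X d f y x' + 1" using ge by (rule add_right_mono)
    finally show ?thesis .
  next
    case False
    then obtain k where k: "L' = Suc k" "L = Suc (Suc k)" using L(2) by (cases L') auto
    have e': "ell X d f y x' = enat (Suc k)" using enat k by simp
    have e: "ell X d f y x = enat (Suc (Suc k))" using L k by simp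
    obtain a where a: "f_upper X d f x (Suc k) = ereal a" "a < y"
      using f_upper_less_of_ell[OF X(1) y e] by metis
    \<comment> \<open>This puts \<open>y\<close> above \<open>f x'\<close> too, so both scores use
      the upper branch.\<close>
    have "ereal (f x') \<le> f_upper X d f x (Suc k)"
      using f_upper_ge[OF X(2), of f k] f_upper_neighbour[OF X nb, of f k] by (rule order_trans)
    then have y': "f x' < y" using a by simp
    obtain a' where a': "f_upper X d f x' k = ereal a'" "ereal y \<le> f_upper X d f x' (Suc k)"
      using f_upper_less_of_ell[OF X(2) y' e'] by metis
    have "(ereal y - ereal a) / (f_upper X d f x (Suc (Suc k)) - ereal a)
        \<le> (ereal y - ereal a') / (f_upper X d f x' (Suc k) - ereal a')"
      using f_upper_neighbour[OF X nb, of f k] f_upper_neighbour[OF X nb, of f "Suc k"] a a'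
      by (intro ereal_fraction_antimono) auto
    then have "ereal (real (Suc (Suc k)))
          + (ereal y - ereal a) / (f_upper X d f x (Suc (Suc k)) - ereal a)
        \<le> ereal (real (Suc (Suc k)))
          + (ereal y - ereal a') / (f_upper X d f x' (Suc k) - ereal a')"
      by (rule add_left_mono)
    \<comment> \<open>The extra level at \<open>x\<close> is exactly the allowed increase of
      1.\<close>
    also have "\<dots> = ereal (real (Suc k))
          + (ereal y - ereal a') / (f_upper X d f x' (Suc k) - ereal a') + 1"
    proof -
      have "ereal (real (Suc (Suc k))) = ereal (real (Suc k)) + 1" by simp
      then show ?thesis by (simp only: ac_simps)
    qed
    finally show ?thesis
      unfolding q_plm_above[OF y e] q_plm_above[OF y' e'] a(1) a'(1) .
  qed
qed

lemma q_plm_neighbour: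
  assumes X: "x \<in> X" "x' \<in> X" and nb: "d x x' \<le> 1"
  shows "q_plm X d f y x' \<le> q_plm X d f y x + 1"
proof -
  have "- q_plm X d f y x \<le> - q_plm X d f y x' + 1"
  proof -
    consider "f x < y" | "f x = y" | "y < f x" by linarith
    then show ?thesis
    proof cases
      case 1
      then show ?thesis using q_plm_neighbour_above[OF X nb] by blast
    next
      case 2
      \<comment> \<open>At \<open>y = f x\<close> the negated score is 1, so nonnegativity at
        \<open>x'\<close> is enough.\<close>
      have "0 \<le> - q_plm X d f y x'"
      proof (cases "ell X d f y x'")
        case (enat L)
        show ?thesis
        proof (cases L)
          case 0
          then show ?thesis using enat q_plm_level_0[of f y x'] by (simp add: zero_enat_def)
        next
          case (Suc k)
          have "0 \<le> ereal (real (Suc k))" by simp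
          also have "\<dots> \<le> - q_plm X d f y x'" using q_plm_bounds[OF X(2)] enat Suc by blast
          finally show ?thesis .
        qed
      next
        case infinity
        then show ?thesis using q_plm_level_infinity[OF X(2)] by simp
      qed
      moreover have "- q_plm X d f y x = 1" using 2 by (simp add: q_plm_def)
      ultimately show ?thesis by (metis add_right_mono add_0)
    next
      case 3
      then show ?thesis
        using q_plm_neighbour_above[OF X nb, of "\<lambda>x. - f x" "- y"] by (simp add: q_plm_uminus)
    qed
  qed
  then show ?thesis
    by (cases "q_plm X d f y x"; cases "q_plm X d f y x'") (auto simp: one_ereal_def)
qed

section \<open>Weights and normalising constants of neighbours\<close>

lemma exp_q_plm_neighbour:
  assumes "x \<in> X" "x' \<in> X" "d x x' \<le> 1" "\<epsilon> > 0"
  shows "exp_ereal (q_plm X d f y x' * ereal (\<epsilon> / 2))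
    \<le> ennreal (exp (\<epsilon> / 2)) * exp_ereal (q_plm X d f y x * ereal (\<epsilon> / 2))"
proof -
  have "q_plm X d f y x' * ereal (\<epsilon> / 2) \<le> (q_plm X d f y x + 1) * ereal (\<epsilon> / 2)"
    using q_plm_neighbour[OF assms(1-3)] assms(4) by (intro ereal_mult_right_mono) auto
  also have "\<dots> = q_plm X d f y x * ereal (\<epsilon> / 2) + ereal (\<epsilon> / 2)"
    using assms(4) by (cases "q_plm X d f y x") (auto simp: one_ereal_def algebra_simps)
  finally show ?thesis
    by (metis mono_exp_ereal exp_ereal_add_real)
qed

lemma Z_plm_neighbour:
  assumes "x \<in> X" "x' \<in> X" "d x x' \<le> 1" "\<epsilon> > 0"
  shows "Z_plm X d f \<epsilon> x' \<le> ennreal (exp (\<epsilon> / 2)) * Z_plm X d f \<epsilon> x"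
proof -
  note borel_measurable_exp_q_plm[measurable]
  show ?thesis
    unfolding Z_plm_def using exp_q_plm_neighbour[OF assms]
    by (subst nn_integral_cmult[symmetric]) (auto intro!: nn_integral_mono)
qed

end

section \<open>The output distribution and privacy\<close>

lemma borel_measurable_M_plm_density:
  "(\<lambda>y. exp_ereal (q_plm X d f y x * ereal (\<epsilon> / 2)) / Z_plm X d f \<epsilon> x) \<in> borel_measurable borel"
  using borel_measurable_exp_q_plm[of X d f x \<epsilon>] by measurable

lemma emeasure_M_plm:
  assumes "S \<in> sets borel"
  shows "emeasure (M_plm X d f \<epsilon> x) S =
    (\<integral>\<^sup>+ y. exp_ereal (q_plm X d f y x * ereal (\<epsilon> / 2)) / Z_plm X d f \<epsilon> x * indicator S y \<partial>lborel)"
  unfolding M_plm_def using assms borel_measurable_M_plm_density[of X d f x \<epsilon>]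
  by (subst emeasure_density) auto

text \<open>The total mass is \<open>Z / Z\<close>, which is 1 for finite \<open>Z\<close> and 0 for
  infinite \<open>Z\<close> by the conventions of \<open>ennreal\<close>. Finiteness is what allows
  the passage from \<open>emeasure\<close> to the real-valued \<open>measure\<close>.\<close>

lemma emeasure_M_plm_finite:
  assumes "S \<in> sets borel" "0 < Z_plm X d f \<epsilon> x"
  shows "emeasure (M_plm X d f \<epsilon> x) S < \<infinity>"
proof -
  note borel_measurable_exp_q_plm[measurable]
  have "emeasure (M_plm X d f \<epsilon> x) S \<le>
      (\<integral>\<^sup>+ y. exp_ereal (q_plm X d f y x * ereal (\<epsilon> / 2)) / Z_plm X d f \<epsilon> x \<partial>lborel)"
    unfolding emeasure_M_plm[OF assms(1)]
    by (intro nn_integral_mono) (auto simp: indicator_def)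
  also have "\<dots> = Z_plm X d f \<epsilon> x / Z_plm X d f \<epsilon> x"
    by (subst nn_integral_divide) (auto simp: Z_plm_def)
  also have "\<dots> < \<infinity>"
    using assms(2) by (cases "Z_plm X d f \<epsilon> x = \<infinity>") (auto simp: ennreal_divide_self less_top)
  finally show ?thesis .
qed

theorem theorem1:
  fixes X :: "'a set" and d :: "'a \<Rightarrow> 'a \<Rightarrow> enat" and f :: "'a \<Rightarrow> real" and \<epsilon> :: real
  assumes d_refl: "\<And>x. x \<in> X \<Longrightarrow> d x x = 0"
    and d_sym: "\<And>x y. x \<in> X \<Longrightarrow> y \<in> X \<Longrightarrow> d x y = d y x"
    and d_triangle: "\<And>x y z. x \<in> X \<Longrightarrow> y \<in> X \<Longrightarrow> z \<in> X \<Longrightarrow> d x z \<le> d x y + d y z"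
    and eps_pos: "\<epsilon> > 0"
    and Z_finite_pos: "\<And>x. x \<in> X \<Longrightarrow> 0 < Z_plm X d f \<epsilon> x \<and> Z_plm X d f \<epsilon> x < \<infinity>"
  shows "differentially_private X d \<epsilon> (M_plm X d f \<epsilon>)"
  unfolding differentially_private_def
proof (intro ballI impI)
  interpret dataset_space X d using d_refl d_sym d_triangle by unfold_locales
  fix x x' and S :: "real set"
  assume x: "x \<in> X" and x': "x' \<in> X" and nb: "d x x' \<le> 1" and S: "S \<in> sets borel"
  have nb': "d x' x \<le> 1" using nb d_sym x x' by metis
  let ?e = "ennreal (exp (\<epsilon> / 2))"
  let ?w = "\<lambda>x y. exp_ereal (q_plm X d f y x * ereal (\<epsilon> / 2))"
  let ?Z = "Z_plm X d f \<epsilon>"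
  \<comment> \<open>Numerator and normalising constant each cost a factor \<open>?e\<close>. The
    weight at \<open>x\<close> is bounded by that at \<open>x'\<close>, but \<open>Z\<close> at
    \<open>x'\<close> by that at \<open>x\<close>, so the score bound is applied in both
    directions.\<close>
  have dens: "?w x y / ?Z x \<le> ennreal (exp \<epsilon>) * (?w x' y / ?Z x')" for y
  proof -
    have "inverse (?Z x) \<le> ?e * inverse (?Z x')"
    proof -
      obtain z z' where z: "?Z x = ennreal z" "0 < z" "?Z x' = ennreal z'" "0 < z'"
        using Z_finite_pos[OF x] Z_finite_pos[OF x'] by (cases "?Z x"; cases "?Z x'") auto
      have "z' \<le> exp (\<epsilon> / 2) * z"
        using Z_plm_neighbour[OF x x' nb eps_pos, of f] z by (simp add: ennreal_mult[symmetric])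
      then show ?thesis
        using z by (simp add: inverse_ennreal ennreal_mult[symmetric] field_simps)
    qed
    then have "?w x y * inverse (?Z x) \<le> (?e * ?w x' y) * (?e * inverse (?Z x'))"
      using exp_q_plm_neighbour[OF x' x nb' eps_pos] by (intro mult_mono) auto
    also have "\<dots> = (?e * ?e) * (?w x' y * inverse (?Z x'))" by (simp add: ac_simps)
    also have "?e * ?e = ennreal (exp \<epsilon>)"
      by (simp add: ennreal_mult[symmetric] exp_add[symmetric])
    finally show ?thesis by (simp add: divide_ennreal_def)
  qed
  have "emeasure (M_plm X d f \<epsilon> x) S
      \<le> (\<integral>\<^sup>+ y. ennreal (exp \<epsilon>) * (?w x' y / ?Z x' * indicator S y) \<partial>lborel)"
    unfolding emeasure_M_plm[OF S]
    by (intro nn_integral_mono) (use dens in \<open>auto simp: indicator_def\<close>)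
  also have "\<dots> = ennreal (exp \<epsilon>) * emeasure (M_plm X d f \<epsilon> x') S"
    unfolding emeasure_M_plm[OF S] using S borel_measurable_M_plm_density[of X d f x' \<epsilon>]
    by (intro nn_integral_cmult) auto
  \<comment> \<open>\<open>enn2real\<close> sends infinity to 0, so it preserves the inequality only
    because the right-hand side is finite.\<close>
  finally have "enn2real (emeasure (M_plm X d f \<epsilon> x) S)
      \<le> enn2real (ennreal (exp \<epsilon>) * emeasure (M_plm X d f \<epsilon> x') S)"
    using emeasure_M_plm_finite[OF S, of X d f \<epsilon> x'] Z_finite_pos[OF x']
    by (intro enn2real_mono) (auto simp: ennreal_mult_less_top)
  then show "measure (M_plm X d f \<epsilon> x) S \<le> exp \<epsilon> * measure (M_plm X d f \<epsilon> x') S"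
    by (simp add: measure_def enn2real_mult)
qed

end
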